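(* Suppose that $\Delta$ is a simplicial complex of subsets of $\{1,\dots,n\}$ with no more than three facets. Then $K_\Delta+Q_\Delta$ is a radical ideal of $S_\Delta$; hence $K_\Delta+Q_\Delta=P_\Delta$.
   Context: $\mathbb K$ is a field, $a_1,\dots,a_n$ positive integers, $R=\mathbb K[x_{i_1,\dots,i_n}:1\le i_j\le a_j]$. For a tuple $\sigma$ with $\sigma_j\in\{1,\dots,a_j\}\cup\{+\}$, $x_\sigma$ is the sum of all $x_{i_1,\dots,i_n}$ with $i_j=\sigma_j$ whenever $\sigma_j\ne+$. A simplicial complex is a nonempty family of subsets closed under subsets; facets are its maximal elements. $S_\Delta$ is the polynomial ring over $\mathbb K$ in variables $X_\sigma$, one for each tuple $\sigma$ with $\sigma_j\in\{1,\dots,a_j\}\cup\{\bullet\}$ and $\{j:\sigma_j\ne\bullet\}\in\Delta$. $\tau_\Delta:S_\Delta\to R$ sends $X_\sigma\mapsto x_{\sigma''}$ ($\bullet$ replaced by $+$), $K_\Delta=\ker\tau_\Delta$. $\eta_\Delta:S_\Delta\to\mathbb K[y_{j,i}:1\le j\le n,\ i\in\{1,\dots,a_j\}\cup\{\bullet\}]$ (the $y_{j,\bullet}$ independent variables) sends $X_\sigma\mapsto\prod_jy_{j,\sigma_j}$, $Q_\Delta=\ker\eta_\Delta$. $\sigma_\Delta:S_\Delta\to\mathbb K[y_{j,i}:1\le i\le a_j]$ sends $X_\sigma\mapsto\prod_jy_{j,\sigma_j}$ with $y_{j,\bullet}$ read as $\sum_iy_{j,i}$, and $P_\Delta=\ker\sigma_\Delta$.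 *)

theory Defs
  imports "HOL-Library.Poly_Mapping"
begin

(* Multivariate polynomials over a field 'k in variables of type 'v are
  represented as ('v <Rightarrow><^sub>0 nat) <Rightarrow><^sub>0 'k (monomial <Rightarrow> coefficient).
  A polynomial ring in a restricted set of variables V is the carrier set
  polys_in V. *)

type_synonym ('v, 'k) mpoly = "('v \<Rightarrow>\<^sub>0 nat) \<Rightarrow>\<^sub>0 'k"

definition polys_in :: "'v set \<Rightarrow> ('v, 'k::zero) mpoly set" where
  "polys_in V = {p. \<forall>m \<in> Poly_Mapping.keys p. Poly_Mapping.keys m \<subseteq> V}"

definition mvar :: "'v \<Rightarrow> ('v, 'k::{zero,one}) mpoly" where
  "mvar v = Poly_Mapping.single (Poly_Mapping.single v 1) 1"

definition mconst :: "'k::zero \<Rightarrow> ('v, 'k) mpoly" where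
  "mconst c = Poly_Mapping.single 0 c"

definition poly_eval :: "('v \<Rightarrow> ('w, 'k::comm_ring_1) mpoly) \<Rightarrow> ('v, 'k) mpoly \<Rightarrow> ('w, 'k) mpoly" where
  "poly_eval g p = (\<Sum>m \<in> Poly_Mapping.keys p.
      mconst (Poly_Mapping.lookup p m) * (\<Prod>v \<in> Poly_Mapping.keys m. g v ^ Poly_Mapping.lookup m v))"

definition ker_on :: "'v set \<Rightarrow> ('v \<Rightarrow> ('w, 'k::comm_ring_1) mpoly) \<Rightarrow> ('v, 'k) mpoly set" where
  "ker_on V g = {p \<in> polys_in V. poly_eval g p = 0}"

definition ideal_sum :: "'a::plus set \<Rightarrow> 'a set \<Rightarrow> 'a set" where
  "ideal_sum I J = {x + y | x y. x \<in> I \<and> y \<in> J}"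

definition radical_in :: "'a::monoid_mult set \<Rightarrow> 'a set \<Rightarrow> bool" where
  "radical_in C I \<longleftrightarrow> (\<forall>f \<in> C. \<forall>m::nat. 0 < m \<longrightarrow> f ^ m \<in> I \<longrightarrow> f \<in> I)"

definition simplicial_complex :: "nat \<Rightarrow> nat set set \<Rightarrow> bool" where
  "simplicial_complex n \<Delta> \<longleftrightarrow> \<Delta> \<noteq> {} \<and> (\<forall>F\<in>\<Delta>. F \<subseteq> {1..n}) \<and>
     (\<forall>F\<in>\<Delta>. \<forall>G. G \<subseteq> F \<longrightarrow> G \<in> \<Delta>)"

definition facets :: "'a set set \<Rightarrow> 'a set set" where
  "facets \<Delta> = {F \<in> \<Delta>. \<forall>G \<in> \<Delta>. F \<subseteq> G \<longrightarrow> G = F}"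

(* Tuples are functions nat <Rightarrow> nat, indexed by j <in> {1..n}, equal to 0
  outside {1..n}. In S_<Delta>-indices and in the linear forms x_<sigma>, the value 0
  encodes the symbols <bullet> resp. +. *)

definition cells :: "nat \<Rightarrow> (nat \<Rightarrow> nat) \<Rightarrow> (nat \<Rightarrow> nat) set" where
  "cells n a = {i. (\<forall>j\<in>{1..n}. 1 \<le> i j \<and> i j \<le> a j) \<and> (\<forall>j. j \<notin> {1..n} \<longrightarrow> i j = 0)}"

definition support :: "nat \<Rightarrow> (nat \<Rightarrow> nat) \<Rightarrow> nat set" where
  "support n \<sigma> = {j \<in> {1..n}. \<sigma> j \<noteq> 0}"

definition S_vars :: "nat \<Rightarrow> (nat \<Rightarrow> nat) \<Rightarrow> nat set set \<Rightarrow> (nat \<Rightarrow> nat) set" where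
  "S_vars n a \<Delta> = {\<sigma>. (\<forall>j\<in>{1..n}. \<sigma> j \<le> a j) \<and> (\<forall>j. j \<notin> {1..n} \<longrightarrow> \<sigma> j = 0)
      \<and> support n \<sigma> \<in> \<Delta>}"

definition xlin :: "nat \<Rightarrow> (nat \<Rightarrow> nat) \<Rightarrow> (nat \<Rightarrow> nat) \<Rightarrow> (nat \<Rightarrow> nat, 'k::comm_ring_1) mpoly" where
  "xlin n a \<sigma> = (\<Sum>i \<in> {i \<in> cells n a. \<forall>j\<in>{1..n}. \<sigma> j \<noteq> 0 \<longrightarrow> i j = \<sigma> j}. mvar i)"

definition tau_map :: "nat \<Rightarrow> (nat \<Rightarrow> nat) \<Rightarrow> (nat \<Rightarrow> nat) \<Rightarrow> (nat \<Rightarrow> nat, 'k::comm_ring_1) mpoly" where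
  "tau_map n a \<sigma> = xlin n a \<sigma>"

(* y-variables are pairs (j,i); i = 0 encodes <bullet>. *)
definition eta_map :: "nat \<Rightarrow> (nat \<Rightarrow> nat) \<Rightarrow> (nat \<times> nat, 'k::comm_ring_1) mpoly" where
  "eta_map n \<sigma> = (\<Prod>j \<in> {1..n}. mvar (j, \<sigma> j))"

definition sigma_map :: "nat \<Rightarrow> (nat \<Rightarrow> nat) \<Rightarrow> (nat \<Rightarrow> nat) \<Rightarrow> (nat \<times> nat, 'k::comm_ring_1) mpoly" where
  "sigma_map n a \<sigma> = (\<Prod>j \<in> {1..n}.
      if \<sigma> j = 0 then (\<Sum>i \<in> {1..a j}. mvar (j, i)) else mvar (j, \<sigma> j))"

definition S_ring :: "nat \<Rightarrow> (nat \<Rightarrow> nat) \<Rightarrow> nat set set \<Rightarrow> (nat \<Rightarrow> nat, 'k::zero) mpoly set" where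
  "S_ring n a \<Delta> = polys_in (S_vars n a \<Delta>)"

definition K_ideal :: "nat \<Rightarrow> (nat \<Rightarrow> nat) \<Rightarrow> nat set set \<Rightarrow> (nat \<Rightarrow> nat, 'k::comm_ring_1) mpoly set" where
  "K_ideal n a \<Delta> = ker_on (S_vars n a \<Delta>) (tau_map n a)"

definition Q_ideal :: "nat \<Rightarrow> (nat \<Rightarrow> nat) \<Rightarrow> nat set set \<Rightarrow> (nat \<Rightarrow> nat, 'k::comm_ring_1) mpoly set" where
  "Q_ideal n a \<Delta> = ker_on (S_vars n a \<Delta>) (eta_map n)"

definition P_ideal :: "nat \<Rightarrow> (nat \<Rightarrow> nat) \<Rightarrow> nat set set \<Rightarrow> (nat \<Rightarrow> nat, 'k::comm_ring_1) mpoly set" where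
  "P_ideal n a \<Delta> = ker_on (S_vars n a \<Delta>) (sigma_map n a)"

end

theory Submission
  imports Defs "HOL-Library.FuncSet" "HOL-Library.Product_Lexorder"
begin

text \<open>
  Both \<open>K\<^sub>\<Delta>\<close> and \<open>Q\<^sub>\<Delta>\<close> lie in the prime ideal \<open>P\<^sub>\<Delta>\<close>, so everything reduces to
  \<open>P\<^sub>\<Delta> \<subseteq> K\<^sub>\<Delta> + Q\<^sub>\<Delta>\<close>. Modulo \<open>K\<^sub>\<Delta>\<close> the value 1 can be eliminated from every index: if
  \<open>\<sigma>\<^sub>j = 1\<close>, then \<open>X\<^sub>\<sigma>\<close> is congruent to the variable with \<open>\<sigma>\<^sub>j\<close> replaced by \<open>\<bullet>\<close> minus the
  variables with \<open>\<sigma>\<^sub>j\<close> replaced by \<open>2, \<dots>, a\<^sub>j\<close>, whose supports again lie in \<open>\<Delta>\<close>. On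
  polynomials without the value 1 the maps \<open>\<sigma>\<^sub>\<Delta>\<close> and \<open>\<eta>\<^sub>\<Delta>\<close> have the same kernel, because
  the forms \<open>\<Sum>\<^sub>i y\<^sub>j\<^sub>,\<^sub>i\<close> and \<open>y\<^sub>j\<^sub>,\<^sub>2, \<dots>\<close> are algebraically independent.
\<close>

section \<open>Substitution homomorphisms\<close>

definition monom_eval :: "('v \<Rightarrow> ('w, 'k::comm_ring_1) mpoly) \<Rightarrow> ('v \<Rightarrow>\<^sub>0 nat) \<Rightarrow> ('w, 'k) mpoly" where
  "monom_eval g m = (\<Prod>v \<in> Poly_Mapping.keys m. g v ^ Poly_Mapping.lookup m v)"

text \<open>Factors outside the keys have exponent 0 and contribute 1; this allows two monomials to
  be evaluated over one common index set.\<close>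

lemma monom_eval_superset:
  assumes "finite A" "Poly_Mapping.keys m \<subseteq> A"
  shows "monom_eval g m = (\<Prod>v\<in>A. g v ^ Poly_Mapping.lookup m v)"
  unfolding monom_eval_def
  by (rule prod.mono_neutral_left) (use assms in \<open>auto simp: in_keys_iff\<close>)

lemma monom_eval_add: "monom_eval g (m + m') = monom_eval g m * monom_eval g m'"
proof -
  let ?A = "Poly_Mapping.keys m \<union> Poly_Mapping.keys m'"
  show ?thesis
    using Poly_Mapping.keys_add[of m m']
    by (simp add: monom_eval_superset[of ?A] lookup_add power_add prod.distrib)
qed

lemma mconst_zero [simp]: "mconst 0 = 0"
  by (simp add: mconst_def)

lemma mconst_one [simp]: "mconst 1 = 1"
  by (simp add: mconst_def)

lemma mconst_add: "mconst (a + b) = mconst a + mconst b"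
  by (simp add: mconst_def single_add)

lemma mconst_mult: "mconst (a * b) = mconst a * mconst (b :: 'k::comm_ring_1)"
  by (simp add: mconst_def mult_single)

lemma poly_eval_monom_eval:
  "poly_eval g p = (\<Sum>m\<in>Poly_Mapping.keys p. mconst (Poly_Mapping.lookup p m) * monom_eval g m)"
  by (simp add: poly_eval_def monom_eval_def)

lemma poly_eval_add: "poly_eval g (p + q) = poly_eval g p + poly_eval g q"
  unfolding poly_eval_monom_eval
  by (rule setsum_keys_plus_distrib) (simp_all add: mconst_add algebra_simps)

lemma poly_eval_zero [simp]: "poly_eval g 0 = 0"
  by (simp add: poly_eval_def)

lemma poly_eval_sum: "poly_eval g (sum f A) = (\<Sum>x\<in>A. poly_eval g (f x))"
  by (induction A rule: infinite_finite_induct) (simp_all add: poly_eval_add)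

lemma poly_eval_diff: "poly_eval g (p - q) = poly_eval g p - poly_eval g q"
  using poly_eval_add[of g "p - q" q] by simp

lemma poly_eval_single: "poly_eval g (Poly_Mapping.single m c) = mconst c * monom_eval g m"
  by (cases "c = 0") (simp_all add: poly_eval_monom_eval)

lemma poly_mapping_sum_singles:
  "p = (\<Sum>m\<in>Poly_Mapping.keys p. Poly_Mapping.single m (Poly_Mapping.lookup p m))"
proof (rule poly_mapping_eqI)
  fix k
  show "Poly_Mapping.lookup p k =
    Poly_Mapping.lookup (\<Sum>m\<in>Poly_Mapping.keys p. Poly_Mapping.single m (Poly_Mapping.lookup p m)) k"
    by (simp add: lookup_sum lookup_single when_def in_keys_iff)
qed

text \<open>Expanding both factors into single terms reduces the claim to
  \<open>monom_eval_add\<close> and \<open>mconst_mult\<close>.\<close>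

lemma poly_eval_mult: "poly_eval g (p * q) = poly_eval g p * poly_eval g q"
proof -
  let ?s = "\<lambda>p m. Poly_Mapping.single m (Poly_Mapping.lookup p m)"
  have "poly_eval g (sum (?s p) A * sum (?s q) B) = poly_eval g (sum (?s p) A) * poly_eval g (sum (?s q) B)"
    for A B
    by (simp add: sum_product poly_eval_sum mult_single poly_eval_single mconst_mult
        monom_eval_add mult_ac)
  from this[of "Poly_Mapping.keys p" "Poly_Mapping.keys q"] show ?thesis
    by (simp flip: poly_mapping_sum_singles)
qed

lemma poly_eval_mconst [simp]: "poly_eval g (mconst c) = mconst c"
  by (simp add: mconst_def poly_eval_single monom_eval_def)

lemma poly_eval_one [simp]: "poly_eval g 1 = 1"
  using poly_eval_mconst[of g 1] by simp

lemma poly_eval_power: "poly_eval g (p ^ k) = poly_eval g p ^ k"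
  by (induction k) (simp_all add: poly_eval_mult)

lemma poly_eval_prod: "poly_eval g (prod f A) = (\<Prod>x\<in>A. poly_eval g (f x))"
  by (induction A rule: infinite_finite_induct) (simp_all add: poly_eval_mult)

lemma poly_eval_mvar [simp]: "poly_eval g (mvar v) = g v"
  by (simp add: mvar_def poly_eval_single monom_eval_def)

lemma poly_eval_poly_eval: "poly_eval h (poly_eval g p) = poly_eval (\<lambda>v. poly_eval h (g v)) p"
  unfolding poly_eval_def[of g] poly_eval_def[of "\<lambda>v. poly_eval h (g v)"]
  by (simp add: poly_eval_sum poly_eval_mult poly_eval_prod poly_eval_power)

lemma poly_eval_cong:
  assumes "p \<in> polys_in V" "\<And>v. v \<in> V \<Longrightarrow> g v = h v"
  shows "poly_eval g p = poly_eval h p"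
  unfolding poly_eval_def
  by (intro sum.cong prod.cong refl arg_cong2[of _ _ _ _ "(*)"] arg_cong2[of _ _ _ _ "(^)"] assms(2))
    (use assms(1) in \<open>auto simp: polys_in_def\<close>)

section \<open>Polynomials in a restricted set of variables\<close>

lemma polys_in_add: "p \<in> polys_in V \<Longrightarrow> q \<in> polys_in V \<Longrightarrow> p + q \<in> polys_in V"
  using Poly_Mapping.keys_add[of p q] by (auto simp: polys_in_def)

lemma polys_in_uminus: "p \<in> polys_in V \<Longrightarrow> - p \<in> polys_in V"
  for p :: "('v, 'k::comm_ring_1) mpoly"
  by (simp add: polys_in_def)

lemma polys_in_diff: "p \<in> polys_in V \<Longrightarrow> q \<in> polys_in V \<Longrightarrow> p - q \<in> polys_in V"
  for p :: "('v, 'k::comm_ring_1) mpoly"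
  using polys_in_add[of p V "- q"] polys_in_uminus[of q V] by simp

lemma polys_in_mult: "p \<in> polys_in V \<Longrightarrow> q \<in> polys_in V \<Longrightarrow> p * q \<in> polys_in V"
  using keys_mult[of p q] by (fastforce simp: polys_in_def dest!: subsetD[OF Poly_Mapping.keys_add])

lemma polys_in_mconst: "mconst c \<in> polys_in V"
  by (auto simp: polys_in_def mconst_def)

lemma polys_in_mvar: "v \<in> V \<Longrightarrow> mvar v \<in> polys_in V"
  by (auto simp: polys_in_def mvar_def split: if_splits)

lemma polys_in_sum: "(\<And>x. x \<in> A \<Longrightarrow> f x \<in> polys_in V) \<Longrightarrow> sum f A \<in> polys_in V"
  by (induction A rule: infinite_finite_induct) (auto simp: polys_in_add, simp_all add: polys_in_def)

lemma polys_in_one: "(1 :: ('v, 'k::comm_ring_1) mpoly) \<in> polys_in V"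
  by (simp add: polys_in_def)

lemma polys_in_power: "p \<in> polys_in V \<Longrightarrow> p ^ k \<in> polys_in V"
  for p :: "('v, 'k::comm_ring_1) mpoly"
  by (induction k) (simp_all add: polys_in_one polys_in_mult)

lemma polys_in_prod: "(\<And>x. x \<in> A \<Longrightarrow> f x \<in> polys_in V) \<Longrightarrow> prod f A \<in> polys_in V"
  for f :: "'b \<Rightarrow> ('v, 'k::comm_ring_1) mpoly"
  by (induction A rule: infinite_finite_induct) (auto simp: polys_in_mult polys_in_one)

lemma polys_in_mono: "V \<subseteq> W \<Longrightarrow> polys_in V \<subseteq> polys_in W"
  by (auto simp: polys_in_def)

lemma poly_eval_in_polys_in:
  assumes "p \<in> polys_in V" "\<And>v. v \<in> V \<Longrightarrow> g v \<in> polys_in W"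
  shows "poly_eval g p \<in> polys_in W"
  unfolding poly_eval_def
  by (intro polys_in_sum polys_in_mult polys_in_mconst polys_in_prod polys_in_power assms(2))
    (use assms(1) in \<open>auto simp: polys_in_def\<close>)

section \<open>Kernels of substitution maps\<close>

text \<open>On the variables in \<open>V\<close>, \<open>h\<close> is \<open>g\<close> followed by
  \<open>f\<close>, so whatever \<open>g\<close> kills is killed by \<open>h\<close>. All three
  kernel comparisons below are instances.\<close>

lemma ker_on_subset_of_factorization:
  assumes "\<And>v. v \<in> V \<Longrightarrow> poly_eval f (g v) = h v"
  shows "ker_on V g \<subseteq> ker_on V h"
proof
  fix p assume p: "p \<in> ker_on V g"
  then have "p \<in> polys_in V"
    by (simp add: ker_on_def)
  then have "poly_eval h p = poly_eval f (poly_eval g p)"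
    unfolding poly_eval_poly_eval by (rule poly_eval_cong) (simp add: assms)
  with p show "p \<in> ker_on V h"
    by (simp add: ker_on_def)
qed

lemma ker_on_add: "p \<in> ker_on V g \<Longrightarrow> q \<in> ker_on V g \<Longrightarrow> p + q \<in> ker_on V g"
  by (simp add: ker_on_def polys_in_add poly_eval_add)

text \<open>In an integral domain a power vanishes only if its base does. The linear order on the
  target variables makes the polynomial type a domain.\<close>

lemma radical_in_ker_on:
  fixes g :: "'v \<Rightarrow> ('w::linorder, 'k::idom) mpoly"
  shows "radical_in (polys_in V) (ker_on V g)"
  by (auto simp: radical_in_def ker_on_def poly_eval_power)

section \<open>The linear forms\<close>

definition compatible_cells :: "nat \<Rightarrow> (nat \<Rightarrow> nat) \<Rightarrow> (nat \<Rightarrow> nat) \<Rightarrow> (nat \<Rightarrow> nat) set" where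
  "compatible_cells n a \<sigma> = {i \<in> cells n a. \<forall>j\<in>{1..n}. \<sigma> j \<noteq> 0 \<longrightarrow> i j = \<sigma> j}"

lemma xlin_compatible_cells: "xlin n a \<sigma> = (\<Sum>i\<in>compatible_cells n a \<sigma>. mvar i)"
  by (simp add: xlin_def compatible_cells_def)

lemma finite_cells: "finite (cells n a)"
proof (rule finite_subset)
  \<comment> \<open>Functions in \<open>PiE\<close> are \<open>undefined\<close> outside the index
    set, tuples are 0 there; this map converts between the conventions.\<close>
  show "cells n a \<subseteq> (\<lambda>f j. if j \<in> {1..n} then f j else 0) ` (\<Pi>\<^sub>E j\<in>{1..n}. {1..a j})"
  proof
    fix i assume i: "i \<in> cells n a"
    then have "i = (\<lambda>j. if j \<in> {1..n} then restrict i {1..n} j else 0)"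
      by (auto simp: cells_def fun_eq_iff)
    moreover have "restrict i {1..n} \<in> (\<Pi>\<^sub>E j\<in>{1..n}. {1..a j})"
      using i by (auto simp: cells_def)
    ultimately show "i \<in> (\<lambda>f j. if j \<in> {1..n} then f j else 0) ` (\<Pi>\<^sub>E j\<in>{1..n}. {1..a j})"
      by (rule image_eqI)
  qed
qed (auto intro!: finite_PiE)

text \<open>Distributivity: the entries of a compatible cell are chosen independently, freely at a
  bullet and as \<open>\<sigma> j\<close> elsewhere. The bound on \<open>\<sigma>\<close> makes the
  prescribed value a legal entry.\<close>

lemma sum_compatible_cells_prod:
  fixes f :: "nat \<Rightarrow> nat \<Rightarrow> 'c::comm_semiring_1"
  assumes "\<forall>j\<in>{1..n}. \<sigma> j \<le> a j"
  shows "(\<Sum>i\<in>compatible_cells n a \<sigma>. \<Prod>j\<in>{1..n}. f j (i j)) =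
    (\<Prod>j\<in>{1..n}. if \<sigma> j = 0 then (\<Sum>i\<in>{1..a j}. f j i) else f j (\<sigma> j))"
    (is "_ = ?rhs")
proof -
  define B where "B j = (if \<sigma> j = 0 then {1..a j} else {\<sigma> j})" for j
  have "?rhs = (\<Prod>j\<in>{1..n}. \<Sum>i\<in>B j. f j i)"
    by (rule prod.cong) (auto simp: B_def)
  also have "\<dots> = (\<Sum>h\<in>Pi\<^sub>E {1..n} B. \<Prod>j\<in>{1..n}. f j (h j))"
    by (rule prod_sum_PiE) (auto simp: B_def)
  also have "\<dots> = (\<Sum>i\<in>compatible_cells n a \<sigma>. \<Prod>j\<in>{1..n}. f j (i j))"
  proof (rule sum.reindex_bij_witness[where i = "\<lambda>i. restrict i {1..n}"
        and j = "\<lambda>h j. if j \<in> {1..n} then h j else 0"])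
    fix h assume h: "h \<in> Pi\<^sub>E {1..n} B"
    then show "restrict (\<lambda>j. if j \<in> {1..n} then h j else 0) {1..n} = h"
      by (auto simp: fun_eq_iff PiE_def extensional_def)
    have "h j \<in> B j" if "j \<in> {1..n}" for j
      using h that by auto
    then show "(\<lambda>j. if j \<in> {1..n} then h j else 0) \<in> compatible_cells n a \<sigma>"
      using assms by (fastforce simp: compatible_cells_def cells_def B_def split: if_splits)
  qed (auto simp: compatible_cells_def cells_def B_def fun_eq_iff)
  finally show ?thesis ..
qed

text \<open>This exhibits the map defining P as \<open>tau_map\<close> followed by the monomial map
  on cells. Cells have no zero entry at a coordinate, so the bullet variables of
  \<open>eta_map\<close> do not arise.\<close>

lemma poly_eval_xlin:
  assumes "\<forall>j\<in>{1..n}. \<sigma> j \<le> a j"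
  shows "poly_eval (eta_map n) (xlin n a \<sigma>) = sigma_map n a \<sigma>"
  using sum_compatible_cells_prod[OF assms, of "\<lambda>j i. mvar (j, i)"]
  by (simp add: xlin_compatible_cells poly_eval_sum eta_map_def sigma_map_def)

text \<open>The compatible cells are partitioned by their \<open>j\<close>-th entry. This is the
  source of the linear relations modulo K that drive the elimination.\<close>

lemma xlin_marginal:
  assumes j: "j \<in> {1..n}" and "\<sigma> j = 0"
  shows "xlin n a \<sigma> = (\<Sum>i\<in>{1..a j}. xlin n a (\<sigma>(j := i)))"
proof -
  let ?A = "compatible_cells n a \<sigma>"
  have fin: "finite ?A"
    using finite_cells by (simp add: compatible_cells_def)
  have *: "compatible_cells n a (\<sigma>(j := i)) = {c \<in> ?A. c j = i}" if "i \<in> {1..a j}" for i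
  proof -
    have "i \<noteq> 0"
      using that by simp
    then have "(\<forall>k\<in>{1..n}. (\<sigma>(j := i)) k \<noteq> 0 \<longrightarrow> c k = (\<sigma>(j := i)) k) \<longleftrightarrow>
      (\<forall>k\<in>{1..n}. \<sigma> k \<noteq> 0 \<longrightarrow> c k = \<sigma> k) \<and> c j = i" for c
      using assms by (metis fun_upd_apply)
    then show ?thesis
      by (simp only: compatible_cells_def mem_Collect_eq conj_assoc)
  qed
  have "(\<lambda>c. c j) ` ?A \<subseteq> {1..a j}"
    using j by (auto simp: compatible_cells_def cells_def)
  then have "xlin n a \<sigma> = (\<Sum>i\<in>{1..a j}. \<Sum>c\<in>{c \<in> ?A. c j = i}. mvar c)"
    unfolding xlin_compatible_cells by (subst sum.group[OF fin]) simp_all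
  also have "\<dots> = (\<Sum>i\<in>{1..a j}. xlin n a (\<sigma>(j := i)))"
    unfolding xlin_compatible_cells using * by (intro sum.cong) (simp_all del: fun_upd_apply)
  finally show ?thesis .
qed

section \<open>Eliminating the value 1\<close>

definition reduced_vars :: "nat \<Rightarrow> (nat \<Rightarrow> nat) \<Rightarrow> nat set set \<Rightarrow> (nat \<Rightarrow> nat) set" where
  "reduced_vars n a \<Delta> = {\<sigma> \<in> S_vars n a \<Delta>. \<forall>j\<in>{1..n}. \<sigma> j \<noteq> 1}"

text \<open>Overwriting an entry that is not a bullet cannot enlarge the support, so closure of
  \<open>\<Delta>\<close> under subsets applies.\<close>

lemma S_vars_update:
  assumes "simplicial_complex n \<Delta>" "\<sigma> \<in> S_vars n a \<Delta>" "j \<in> {1..n}" "\<sigma> j \<noteq> 0" "i \<le> a j"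
  shows "\<sigma>(j := i) \<in> S_vars n a \<Delta>"
proof -
  have "support n (\<sigma>(j := i)) \<subseteq> support n \<sigma>"
    using assms by (auto simp: support_def)
  then have "support n (\<sigma>(j := i)) \<in> \<Delta>"
    using assms by (auto simp: simplicial_complex_def S_vars_def)
  then show ?thesis
    using assms by (auto simp: S_vars_def)
qed

text \<open>Induction on the number of entries equal to 1: replacing one of them by another value
  lowers that number, and the marginal relation expresses \<open>\<sigma>\<close> through the
  replacements. Equal images under \<open>tau_map\<close> mean congruence modulo K.\<close>

lemma exists_reduced_form:
  assumes sc: "simplicial_complex n \<Delta>" and "\<sigma> \<in> S_vars n a \<Delta>"
  shows "\<exists>q \<in> polys_in (reduced_vars n a \<Delta>).
    poly_eval (tau_map n a) q = (tau_map n a \<sigma> :: (nat \<Rightarrow> nat, 'k::comm_ring_1) mpoly)"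
  using assms(2)
proof (induction "card {j \<in> {1..n}. \<sigma> j = 1}" arbitrary: \<sigma> rule: less_induct)
  case less
  show ?case
  proof (cases "\<exists>j\<in>{1..n}. \<sigma> j = 1")
    case False
    then have "mvar \<sigma> \<in> polys_in (reduced_vars n a \<Delta>)"
      using less.prems by (intro polys_in_mvar) (auto simp: reduced_vars_def)
    then show ?thesis
      by (intro bexI[of _ "mvar \<sigma>"]) simp_all
  next
    case True
    then obtain j where j: "j \<in> {1..n}" "\<sigma> j = 1"
      by blast
    have aj: "1 \<le> a j"
      using less.prems j by (force simp: S_vars_def)
    have "\<exists>q \<in> polys_in (reduced_vars n a \<Delta>).
      poly_eval (tau_map n a) q = (tau_map n a (\<sigma>(j := i)) :: (nat \<Rightarrow> nat, 'k) mpoly)"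
      \<comment> \<open>The bullet, coded 0, and every value except the one being
        eliminated.\<close>
      if "i \<in> {0..a j} - {1}" for i
    proof (rule less.hyps)
      have "{k \<in> {1..n}. (\<sigma>(j := i)) k = 1} \<subset> {k \<in> {1..n}. \<sigma> k = 1}"
        using j that by auto
      then show "card {k \<in> {1..n}. (\<sigma>(j := i)) k = 1} < card {k \<in> {1..n}. \<sigma> k = 1}"
        by (rule psubset_card_mono[rotated]) simp
      show "\<sigma>(j := i) \<in> S_vars n a \<Delta>"
        using sc less.prems j that by (intro S_vars_update) auto
    qed
    then obtain q where q: "\<And>i. i \<in> {0..a j} - {1} \<Longrightarrow> q i \<in> polys_in (reduced_vars n a \<Delta>)"
      "\<And>i. i \<in> {0..a j} - {1} \<Longrightarrow>
        poly_eval (tau_map n a) (q i) = (tau_map n a (\<sigma>(j := i)) :: (nat \<Rightarrow> nat, 'k) mpoly)"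
      by metis
    have "tau_map n a (\<sigma>(j := 0)) = (\<Sum>i\<in>{1..a j}. tau_map n a (\<sigma>(j := i)) :: (nat \<Rightarrow> nat, 'k) mpoly)"
      using xlin_marginal[of j n "\<sigma>(j := 0)" a] j by (simp add: tau_map_def)
    also have "{1..a j} = insert 1 {2..a j}"
      using aj by auto
    also have "(\<Sum>i\<in>insert 1 {2..a j}. tau_map n a (\<sigma>(j := i))) =
      tau_map n a \<sigma> + (\<Sum>i\<in>{2..a j}. tau_map n a (\<sigma>(j := i)) :: (nat \<Rightarrow> nat, 'k) mpoly)"
      \<comment> \<open>The summand for \<open>i = 1\<close> is \<open>\<sigma>\<close>
        itself.\<close>
      using fun_upd_idem[of \<sigma> j 1] j(2) by simp
    finally have marginal: "tau_map n a (\<sigma>(j := 0)) =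
      tau_map n a \<sigma> + (\<Sum>i\<in>{2..a j}. tau_map n a (\<sigma>(j := i)) :: (nat \<Rightarrow> nat, 'k) mpoly)" .
    \<comment> \<open>The marginal relation, solved for \<open>\<sigma>\<close>.\<close>
    have "poly_eval (tau_map n a) (q 0 - (\<Sum>i\<in>{2..a j}. q i)) = tau_map n a \<sigma>"
      using marginal q(2) by (simp add: poly_eval_diff poly_eval_sum del: fun_upd_apply)
    moreover have "q 0 - (\<Sum>i\<in>{2..a j}. q i) \<in> polys_in (reduced_vars n a \<Delta>)"
      using q(1) by (intro polys_in_diff polys_in_sum) auto
    ultimately show ?thesis
      by blast
  qed
qed

text \<open>Inverts the linear change of variables \<open>y\<^sub>j\<^sub>,\<^sub>\<bullet> = \<Sum>\<^sub>i y\<^sub>j\<^sub>,\<^sub>i\<close>, solved for \<open>y\<^sub>j\<^sub>,\<^sub>1\<close>.\<close>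

definition solve_first :: "(nat \<Rightarrow> nat) \<Rightarrow> nat \<times> nat \<Rightarrow> (nat \<times> nat, 'k::comm_ring_1) mpoly" where
  "solve_first a = (\<lambda>(j, i). if i = 1 then mvar (j, 0) - (\<Sum>l\<in>{2..a j}. mvar (j, l)) else mvar (j, i))"

text \<open>At a bullet, the image of the variable \<open>(j, 1)\<close> cancels the rest of the sum
  and leaves \<open>mvar (j, 0)\<close>; positivity of \<open>a j\<close> ensures that
  \<open>(j, 1)\<close> occurs. The other factors have index at least 2 and stay fixed.\<close>

lemma poly_eval_solve_first:
  assumes "\<forall>j\<in>{1..n}. 0 < a j" "\<forall>j\<in>{1..n}. \<sigma> j \<noteq> 1"
  shows "poly_eval (solve_first a) (sigma_map n a \<sigma>) = eta_map n \<sigma>"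
proof -
  have "(\<Sum>i\<in>{1..a j}. solve_first a (j, i)) = (mvar (j, 0) :: (nat \<times> nat, 'k::comm_ring_1) mpoly)"
    if "j \<in> {1..n}" for j
  proof -
    have "{1..a j} = insert 1 {2..a j}"
      using assms(1) that by force
    then show ?thesis
      by (simp add: solve_first_def)
  qed
  then show ?thesis
    unfolding sigma_map_def eta_map_def poly_eval_prod using assms(2)
    by (intro prod.cong) (auto simp: poly_eval_sum solve_first_def)
qed

section \<open>Comparison of the three ideals\<close>

lemma K_ideal_subset_P_ideal: "K_ideal n a \<Delta> \<subseteq> P_ideal n a \<Delta>"
  unfolding K_ideal_def P_ideal_def
  by (rule ker_on_subset_of_factorization[of _ "eta_map n"])
    (auto simp: tau_map_def S_vars_def poly_eval_xlin)

text \<open>Specializing each bullet variable to the sum of the other variables with the same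
  \<open>j\<close> turns \<open>eta_map\<close> into \<open>sigma_map\<close>.\<close>

lemma Q_ideal_subset_P_ideal: "Q_ideal n a \<Delta> \<subseteq> P_ideal n a \<Delta>"
  unfolding Q_ideal_def P_ideal_def
  by (rule ker_on_subset_of_factorization[of _
        "\<lambda>(j, i). if i = 0 then (\<Sum>l\<in>{1..a j}. mvar (j, l)) else mvar (j, i)"])
    (simp add: eta_map_def sigma_map_def poly_eval_prod)

lemma P_ideal_subset_ideal_sum:
  assumes pos: "\<forall>j\<in>{1..n}. 0 < a j" and sc: "simplicial_complex n \<Delta>"
  shows "(P_ideal n a \<Delta> :: (nat \<Rightarrow> nat, 'k::comm_ring_1) mpoly set)
    \<subseteq> ideal_sum (K_ideal n a \<Delta>) (Q_ideal n a \<Delta>)"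
proof
  fix p :: "(nat \<Rightarrow> nat, 'k) mpoly"
  assume p: "p \<in> P_ideal n a \<Delta>"
  then have pV: "p \<in> polys_in (S_vars n a \<Delta>)"
    by (simp add: P_ideal_def ker_on_def)
  have "\<forall>v\<in>S_vars n a \<Delta>. \<exists>q :: (nat \<Rightarrow> nat, 'k) mpoly.
    q \<in> polys_in (reduced_vars n a \<Delta>) \<and> poly_eval (tau_map n a) q = tau_map n a v"
    using exists_reduced_form[OF sc] by blast
  from bchoice[OF this] obtain r :: "(nat \<Rightarrow> nat) \<Rightarrow> (nat \<Rightarrow> nat, 'k) mpoly"
    where r: "\<And>v. v \<in> S_vars n a \<Delta> \<Longrightarrow> r v \<in> polys_in (reduced_vars n a \<Delta>)"
      "\<And>v. v \<in> S_vars n a \<Delta> \<Longrightarrow> poly_eval (tau_map n a) (r v) = tau_map n a v"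
    by blast
  \<comment> \<open>Every variable of \<open>p\<close> is replaced by its reduced form; the
    decomposition sought is \<open>p = (p - q) + q\<close>.\<close>
  define q where "q = poly_eval r p"
  have q_red: "q \<in> polys_in (reduced_vars n a \<Delta>)"
    unfolding q_def using pV r(1) by (rule poly_eval_in_polys_in)
  then have qV: "q \<in> polys_in (S_vars n a \<Delta>)"
    using polys_in_mono[of "reduced_vars n a \<Delta>" "S_vars n a \<Delta>"] by (auto simp: reduced_vars_def)
  have "poly_eval (tau_map n a) q = poly_eval (tau_map n a) p"
    unfolding q_def poly_eval_poly_eval using pV r(2) by (rule poly_eval_cong)
  then have K: "p - q \<in> K_ideal n a \<Delta>"
    using pV qV by (simp add: K_ideal_def ker_on_def polys_in_diff poly_eval_diff)
  then have "p - q \<in> P_ideal n a \<Delta>"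
    using K_ideal_subset_P_ideal by blast
  then have "poly_eval (sigma_map n a) q = 0"
    using p by (simp add: P_ideal_def ker_on_def poly_eval_diff)
  then have "q \<in> ker_on (reduced_vars n a \<Delta>) (sigma_map n a)"
    using q_red by (simp add: ker_on_def)
  \<comment> \<open>Without the value 1, \<open>solve_first\<close> recovers \<open>eta_map\<close>
    from \<open>sigma_map\<close>.\<close>
  also have "\<dots> \<subseteq> ker_on (reduced_vars n a \<Delta>) (eta_map n)"
    by (rule ker_on_subset_of_factorization[of _ "solve_first a"])
      (auto simp: reduced_vars_def intro!: poly_eval_solve_first[OF pos])
  finally have "q \<in> Q_ideal n a \<Delta>"
    using qV by (simp add: Q_ideal_def ker_on_def)
  with K show "p \<in> ideal_sum (K_ideal n a \<Delta>) (Q_ideal n a \<Delta>)"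
    unfolding ideal_sum_def mem_Collect_eq
    by (intro exI[of _ "p - q"] exI[of _ q]) simp
qed

lemma ideal_sum_K_Q_eq_P:
  assumes "\<forall>j\<in>{1..n}. 0 < a j" "simplicial_complex n \<Delta>"
  shows "ideal_sum (K_ideal n a \<Delta>) (Q_ideal n a \<Delta>) =
    (P_ideal n a \<Delta> :: (nat \<Rightarrow> nat, 'k::comm_ring_1) mpoly set)"
proof
  show "ideal_sum (K_ideal n a \<Delta>) (Q_ideal n a \<Delta>) \<subseteq> (P_ideal n a \<Delta> :: (nat \<Rightarrow> nat, 'k) mpoly set)"
    using K_ideal_subset_P_ideal[of n a \<Delta>] Q_ideal_subset_P_ideal[of n a \<Delta>]
    unfolding ideal_sum_def P_ideal_def by (blast intro: ker_on_add)
qed (rule P_ideal_subset_ideal_sum[OF assms])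

theorem theorem7p4:
  fixes n :: nat and a :: "nat \<Rightarrow> nat" and \<Delta> :: "nat set set"
  assumes "\<forall>j\<in>{1..n}. 0 < a j"
    and "simplicial_complex n \<Delta>"
    and "card (facets \<Delta>) \<le> 3"
  shows "radical_in (S_ring n a \<Delta> :: (nat \<Rightarrow> nat, 'k::field) mpoly set)
            (ideal_sum (K_ideal n a \<Delta>) (Q_ideal n a \<Delta>))
       \<and> ideal_sum (K_ideal n a \<Delta>) (Q_ideal n a \<Delta>) = (P_ideal n a \<Delta> :: (nat \<Rightarrow> nat, 'k) mpoly set)"
  \<comment> \<open>Once the sum is identified with P, radicality is that of a kernel into a domain;
    the pairs \<open>(j, i)\<close> carry the lexicographic order.\<close>
  unfolding ideal_sum_K_Q_eq_P[OF assms(1,2)] S_ring_def P_ideal_def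
  by (simp add: radical_in_ker_on)

end
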